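(* We have $$1+\sum_{n=1}^\infty\big(q^{n^2}+q^{5n^2}\big)=\frac{(q^2,q^8,q^{10};q^{10})_\infty\,(q^6,q^{14};q^{20})_\infty}{(q,q^4;q^5)_\infty}.$$
   Context: Here $q$ is a complex number with $|q|<1$ (equivalently, the identity may be read as an identity of formal power series in $q$). For a complex number $a$, $(a;q)_\infty:=\prod_{i=0}^\infty(1-aq^i)$, and $(a_1,a_2,\dots,a_m;q)_\infty:=\prod_{j=1}^m(a_j;q)_\infty$. *)

theory Defs
  imports "HOL-Analysis.Analysis"
begin

definition qpochhammer_inf :: "complex \<Rightarrow> complex \<Rightarrow> complex" where
  "qpochhammer_inf a q = (\<Prod>i. 1 - a * q ^ i)"

definition qpochhammer_inf_list :: "complex list \<Rightarrow> complex \<Rightarrow> complex" where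
  "qpochhammer_inf_list as q = (\<Prod>a\<leftarrow>as. qpochhammer_inf a q)"

end

theory Submission
  imports Defs
begin

text \<open>
  Write $f(a,b) = \sum_{n} a^{n(n+1)/2} b^{n(n-1)/2}$, $\varphi(q) = f(q,q)$, $\psi(q) = f(q^3,q)$. The left-hand
  side is $(\varphi(q) + \varphi(q^5))/2$. With $A = f(-q^3,-q^2) f(-q^{12},-q^8)$ and
  $B = q f(-q^4,-q) f(-q^{16},-q^4)$, Rogers' identities for the Rogers--Ramanujan functions say
  $A + B = \varphi(q)\psi(-q)$ and $A - B = \varphi(q^5)\psi(-q)$; adding them, the theorem becomes a rearrangement of the
  product for $A / \psi(-q)$.

  By the triple product $\varphi(q)\psi(-q) = \varphi(-q^2)\psi(q)$, a theta series on $\mathbb{Z}[i]$; splitting it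
  into the five cosets of a prime of norm 5 gives the first identity. Splitting $\varphi(q)^2$ in the same way
  gives $\varphi(q)^2 - \varphi(q^5)^2 = 4 q f(q^9,q) f(q^7,q^3)$. Since $AB = q f(q^9,q) f(q^7,q^3) \psi(-q)^2$, this yields
  $(A-B)^2 = \varphi(q^5)^2 \psi(-q)^2$, and continuity in $q$ fixes the sign.
\<close>

section \<open>Infinite products and interchange of limit and sum\<close>

lemma convergent_prod_qpochhammer:
  fixes a q :: complex
  assumes "norm q < 1"
  shows "convergent_prod (\<lambda>i. 1 - a * q ^ i)"
proof (intro abs_convergent_prod_imp_convergent_prod summable_imp_abs_convergent_prod)
  have "summable (\<lambda>i. norm a * norm q ^ i)"
    using assms by (intro summable_mult summable_geometric) auto
  thus "summable (\<lambda>i. norm (1 - a * q ^ i - 1))"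
    by (simp add: norm_mult norm_power)
qed

lemma qpochhammer_inf_LIMSEQ:
  assumes "norm q < 1"
  shows "(\<lambda>n. \<Prod>i<n. 1 - a * q ^ i) \<longlonglongrightarrow> qpochhammer_inf a q"
  using convergent_prod_LIMSEQ[OF convergent_prod_qpochhammer[OF assms, of a]]
  unfolding qpochhammer_inf_def lessThan_Suc_atMost[symmetric]
  by (subst (asm) filterlim_sequentially_Suc)

lemma qpochhammer_inf_nonzero:
  assumes "norm q < 1" "norm a < 1"
  shows "qpochhammer_inf a q \<noteq> 0"
  unfolding qpochhammer_inf_def
proof (rule prodinf_nonzero[OF convergent_prod_qpochhammer[OF assms(1)]])
  fix i
  have "norm (a * q ^ i) \<le> norm a * 1"
    unfolding norm_mult norm_power using assms by (intro mult_left_mono power_le_one) auto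
  with assms show "1 - a * q ^ i \<noteq> 0" by auto
qed

text \<open>Tannery's theorem: by the Weierstrass M-test the finite partial sums converge uniformly
  on \<open>Y\<close>, so the limit along \<open>F\<close> may be taken term by term. It carries the
  finite triple product over to the infinite one.\<close>

lemma infsum_dominated_convergence:
  fixes f :: "'a \<Rightarrow> 'b \<Rightarrow> 'c :: banach" and M :: "'a \<Rightarrow> real"
  assumes lim: "\<And>x. x \<in> A \<Longrightarrow> (f x \<longlongrightarrow> g x) F"
    and bound: "\<And>x y. x \<in> A \<Longrightarrow> y \<in> Y \<Longrightarrow> norm (f x y) \<le> M x"
    and M: "M summable_on A" and Y: "eventually (\<lambda>y. y \<in> Y) F" and F: "F \<noteq> bot"
  shows "((\<lambda>y. \<Sum>\<^sub>\<infinity>x\<in>A. f x y) \<longlongrightarrow> (\<Sum>\<^sub>\<infinity>x\<in>A. g x)) F"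
proof (rule swap_uniform_limit')
  show "\<forall>\<^sub>F X in finite_subsets_at_top A. ((\<lambda>y. \<Sum>x\<in>X. f x y) \<longlongrightarrow> (\<Sum>x\<in>X. g x)) F"
    using lim by (intro eventually_finite_subsets_at_top_weakI tendsto_sum) auto
  have "norm (g x) \<le> M x" if "x \<in> A" for x
  proof (rule tendsto_upperbound[OF tendsto_norm[OF lim[OF that]] _ F])
    show "\<forall>\<^sub>F y in F. norm (f x y) \<le> M x"
      using Y by eventually_elim (use bound that in auto)
  qed
  hence "g summable_on A"
    using M abs_summable_summable Infinite_Sum.abs_summable_on_comparison_test' by blast
  thus "((\<lambda>X. \<Sum>x\<in>X. g x) \<longlongrightarrow> (\<Sum>\<^sub>\<infinity>x\<in>A. g x)) (finite_subsets_at_top A)"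
    by (rule infsum_tendsto)
  show "uniform_limit Y (\<lambda>X y. \<Sum>x\<in>X. f x y) (\<lambda>y. \<Sum>\<^sub>\<infinity>x\<in>A. f x y) (finite_subsets_at_top A)"
    using bound M by (rule Weierstrass_m_test_general)
qed (use Y in auto)

section \<open>Ramanujan's theta function and the Jacobi triple product\<close>

text \<open>Since \<open>n * (n + 1)\<close> is even and nonnegative for every integer, neither
  \<open>div\<close> nor \<open>nat\<close> loses anything. Natural exponents keep theta terms
  meaningful when a base is 0.\<close>

definition tri :: "int \<Rightarrow> nat" where
  "tri n = nat (n * (n + 1) div 2)"

lemma tri_eq: "2 * int (tri n) = n * (n + 1)"
proof -
  have "n * (n + 1) \<ge> 0" by (cases "n \<ge> 0") (auto simp: mult_nonpos_nonpos)
  thus ?thesis unfolding tri_def by simp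
qed

lemma tri_0 [simp]: "tri 0 = 0"
  by (simp add: tri_def)

lemma tri_add_tri_minus: "int (tri n + tri (- n)) = n\<^sup>2"
  using tri_eq[of n] tri_eq[of "-n"] by (simp add: algebra_simps power2_eq_square)

text \<open>A linear lower bound suffices for a geometric majorant. The loss of 1 is forced by
  \<open>tri (-1) = 0\<close>.\<close>

lemma tri_ge: "tri n \<ge> nat \<bar>n\<bar> - 1"
proof -
  have "2 * (\<bar>n\<bar> - 1) \<le> n * (n + 1)"
  proof (cases "n \<ge> 0")
    case True
    have "n * (n + 1) - 2 * (n - 1) = (n - 1)\<^sup>2 + n + 1" by (simp add: power2_eq_square algebra_simps)
    with True show ?thesis by (smt (verit) zero_le_power2)
  next
    case False
    have "n * (n + 1) - 2 * (- n - 1) = (n + 1) * (n + 2)" by (simp add: algebra_simps)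
    moreover have "(n + 1) * (n + 2) \<ge> 0"
      using False by (cases "n = -1") (auto intro: mult_nonpos_nonpos)
    ultimately show ?thesis using False by linarith
  qed
  thus ?thesis using tri_eq[of n] by (simp add: le_diff_conv nat_le_iff)
qed

definition theta_term :: "complex \<Rightarrow> complex \<Rightarrow> int \<Rightarrow> complex" where
  "theta_term a b n = a ^ tri n * b ^ tri (- n)"

text \<open>This is Ramanujan's $f(a,b)$, whose exponents are $n(n+1)/2$ for $a$ and $n(n-1)/2$ for $b$.\<close>

definition theta :: "complex \<Rightarrow> complex \<Rightarrow> complex" where
  "theta a b = (\<Sum>\<^sub>\<infinity>n. theta_term a b n)"

lemma theta_term_0 [simp]: "theta_term a b 0 = 1"
  by (simp add: theta_term_def)

lemma theta_term_minus: "theta_term a b (- n) = theta_term b a n"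
  by (simp add: theta_term_def mult.commute)

text \<open>Because \<open>tri k - tri (k - 1) = k\<close>, the exponents of \<open>a\<close> and of
  \<open>b\<close> both change by \<open>n + 1 - k\<close>, which makes the quotient of the terms a
  power of \<open>a * b\<close>. That power is the weight in the q-Pascal rule
  \<open>qbinom_Suc\<close>.\<close>

lemma theta_term_step_up:
  assumes "k \<le> int n + 1"
  shows "a * (a * b) ^ n * theta_term a b (k - 1) = (a * b) ^ nat (int n + 1 - k) * theta_term a b k"
proof -
  have 1: "int (tri (k - 1)) = int (tri k) - k"
    using tri_eq[of "k-1"] tri_eq[of k] by (simp add: algebra_simps)
  have 2: "int (tri (1 - k)) = int (tri (-k)) + 1 - k"
    using tri_eq[of "1-k"] tri_eq[of "-k"] by (simp add: algebra_simps)
  have "Suc (n + tri (k - 1)) = nat (int n + 1 - k) + tri k"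
       "n + tri (1 - k) = nat (int n + 1 - k) + tri (- k)"
    using 1 2 assms by linarith+
  moreover have "a * (a * b) ^ n * theta_term a b (k - 1) = a ^ Suc (n + tri (k - 1)) * b ^ (n + tri (1 - k))"
    by (simp add: theta_term_def power_add power_mult_distrib)
  ultimately show ?thesis
    by (simp only:) (simp add: theta_term_def power_add power_mult_distrib)
qed

lemma theta_term_step_down:
  assumes "- k \<le> int n + 1"
  shows "b * (a * b) ^ n * theta_term a b (k + 1) = (a * b) ^ nat (int n + 1 + k) * theta_term a b k"
  using theta_term_step_up[of "-k" n b a] assms theta_term_minus[of b a "k+1"] theta_term_minus[of b a k]
  by (simp add: mult.commute)

lemma summable_on_power_abs_int:
  fixes r :: real
  assumes "0 \<le> r" "r < 1"
  shows "(\<lambda>n::int. r ^ (nat \<bar>n\<bar> - 1)) summable_on UNIV"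
proof -
  have 0: "(\<lambda>n. r ^ (n - 1)) summable_on (UNIV :: nat set)"
  proof (subst summable_on_UNIV_nonneg_real_iff)
    have "summable (\<lambda>n. r ^ (Suc n - 1))"
      using assms by (simp add: summable_geometric)
    thus "summable (\<lambda>n. r ^ (n - 1))" by (subst (asm) summable_Suc_iff)
  qed (use assms in auto)
  have 1: "(\<lambda>n::int. r ^ (nat \<bar>n\<bar> - 1)) summable_on {0..}"
    using 0 by (subst summable_on_reindex_bij_witness[of _ int nat UNIV "\<lambda>n. r ^ (n - 1)"]) auto
  have 2: "(\<lambda>n::int. r ^ (nat \<bar>n\<bar> - 1)) summable_on {..0}"
    using 0 by (subst summable_on_reindex_bij_witness[of _ "\<lambda>n. - int n" "\<lambda>n. nat (-n)" UNIV "\<lambda>n. r ^ (n - 1)"]) auto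
  have "{0..} \<union> {..0} = (UNIV :: int set)" by auto
  with summable_on_union[OF 1 2] show ?thesis by simp
qed

text \<open>Extracting the smaller of the two exponents leaves a power of \<open>a * b\<close> times
  factors of norm at most 1. So only the product has to be small and one argument may lie on the
  unit circle; a uniform \<open>r\<close> gives uniform convergence.\<close>

lemma norm_theta_term_le:
  assumes "norm a \<le> 1" "norm b \<le> 1" "norm (a * b) \<le> r" "r < 1"
  shows "norm (theta_term a b n) \<le> r ^ (nat \<bar>n\<bar> - 1)"
proof -
  define m where "m = min (tri n) (tri (- n))"
  have "norm (theta_term a b n) = norm a ^ tri n * norm b ^ tri (- n)"
    by (simp add: theta_term_def norm_mult norm_power)
  also have "\<dots> \<le> norm a ^ m * norm b ^ m"
    using assms by (intro mult_mono power_decreasing) (auto simp: m_def)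
  also have "\<dots> = norm (a * b) ^ m"
    by (simp add: norm_mult power_mult_distrib)
  also have "\<dots> \<le> r ^ m" using assms by (intro power_mono) auto
  also have "\<dots> \<le> r ^ (nat \<bar>n\<bar> - 1)"
    using assms tri_ge[of n] tri_ge[of "-n"] norm_ge_zero[of "a * b"] unfolding m_def
    by (intro power_decreasing) (auto simp del: norm_ge_zero)
  finally show ?thesis .
qed

lemma abs_summable_theta_term:
  assumes "norm a \<le> 1" "norm b \<le> 1" "norm (a * b) < 1"
  shows "(\<lambda>n. norm (theta_term a b n)) summable_on UNIV"
  by (rule Infinite_Sum.abs_summable_on_comparison_test'[OF summable_on_power_abs_int[of "norm (a * b)"]])
     (use assms norm_theta_term_le in auto)

lemma theta_has_sum:
  assumes "norm a \<le> 1" "norm b \<le> 1" "norm (a * b) < 1"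
  shows "(theta_term a b has_sum theta a b) UNIV"
  unfolding theta_def using abs_summable_summable[OF abs_summable_theta_term[OF assms]] by simp

section \<open>Gaussian binomial coefficients and the finite triple product\<close>

definition qfact :: "complex \<Rightarrow> nat \<Rightarrow> complex" where
  "qfact p n = (\<Prod>i<n. 1 - p * p ^ i)"

text \<open>The Gaussian binomial coefficient. An integer lower index with value 0 outside the range
  lets sums run over all integers and be shifted freely.\<close>

definition qbinom :: "complex \<Rightarrow> nat \<Rightarrow> int \<Rightarrow> complex" where
  "qbinom p n k = (if 0 \<le> k \<and> k \<le> int n then qfact p n / (qfact p (nat k) * qfact p (nat (int n - k))) else 0)"

lemma qfact_0 [simp]: "qfact p 0 = 1"
  and qfact_Suc: "qfact p (Suc n) = qfact p n * (1 - p ^ Suc n)"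
  by (simp_all add: qfact_def)

lemma power_neq_1:
  assumes "norm (p :: complex) < 1" shows "p ^ Suc n \<noteq> 1"
proof
  assume "p ^ Suc n = 1"
  hence "norm p ^ Suc n = 1" by (metis norm_one norm_power)
  moreover have "norm p ^ Suc n \<le> norm p" using assms by (intro power_Suc_le_self) auto
  ultimately show False using assms by simp
qed

lemma qfact_nonzero: "norm p < 1 \<Longrightarrow> qfact p n \<noteq> 0"
  by (induction n) (use power_neq_1 in \<open>auto simp: qfact_Suc simp del: power_Suc\<close>)

lemma qbinom_symmetric: "qbinom p n (int n - k) = qbinom p n k"
  by (auto simp: qbinom_def mult.commute)

lemma qbinom_nat:
  "qbinom p (i + m) (int i) = qfact p (i + m) / (qfact p i * qfact p m)"
  by (simp add: qbinom_def)

text \<open>The q-Pascal rule. With \<open>k = i + 1\<close> and \<open>n = i + m + 1\<close>,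
  clearing denominators leaves
  \<open>1 - p^(n+1) = (1 - p^(m+1)) + p^(m+1) * (1 - p^(i+1))\<close>.\<close>

lemma qbinom_Suc:
  assumes p: "norm p < 1"
  shows "qbinom p (Suc n) k = qbinom p n k + p ^ nat (int n + 1 - k) * qbinom p n (k - 1)"
proof -
  consider "k < 0" | "k = 0" | "1 \<le> k" "k \<le> int n" | "k = int n + 1" | "k > int n + 1" by linarith
  thus ?thesis
  proof cases
    case 3
    define i m where "i = nat (k - 1)" and "m = nat (int n - k)"
    have k: "k = int (Suc i)" and n: "n = Suc (i + m)" and e: "nat (int n + 1 - k) = Suc m"
      using 3 by (auto simp: i_def m_def)
    have "qbinom p (Suc n) k = qfact p (Suc n) / (qfact p (Suc i) * qfact p (Suc m))"
      using qbinom_nat[of p "Suc i" "Suc m"] by (simp add: k n)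
    moreover have "qbinom p n k = qfact p n / (qfact p (Suc i) * qfact p m)"
      using qbinom_nat[of p "Suc i" "m"] by (simp add: k n)
    moreover have "qbinom p n (k - 1) = qfact p n / (qfact p i * qfact p (Suc m))"
      using qbinom_nat[of p i "Suc m"] by (simp add: k n)
    moreover have "p ^ Suc n = p ^ Suc i * p ^ Suc m" by (simp add: n power_add)
    moreover have "qfact p i \<noteq> 0" "qfact p m \<noteq> 0" "1 - p ^ Suc i \<noteq> 0" "1 - p ^ Suc m \<noteq> 0"
      using p qfact_nonzero power_neq_1 by auto
    ultimately show ?thesis
      unfolding e qfact_Suc by (simp only:) (simp add: divide_simps del: power_Suc, simp add: algebra_simps del: power_Suc)
  qed (use qfact_nonzero[OF p] in \<open>auto simp: qbinom_def nat_add_distrib\<close>)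
qed

lemma qbinom_Suc':
  assumes p: "norm p < 1"
  shows "qbinom p (Suc n) k = qbinom p n (k - 1) + p ^ nat k * qbinom p n k"
  using qbinom_Suc[OF p, of n "int (Suc n) - k"] qbinom_symmetric[of p "Suc n" k]
    qbinom_symmetric[of p n "k - 1"] qbinom_symmetric[of p n k]
  by (simp add: algebra_simps)

text \<open>Induction on \<open>n\<close>, multiplying by one new factor at a time:
  \<open>1 + a * (a * b) ^ n\<close> raises the upper index from \<open>2 * n\<close> to
  \<open>2 * n + 1\<close> by the first Pascal rule, and \<open>1 + b * (a * b) ^ n\<close> raises
  it to \<open>2 * n + 2\<close> by the second.\<close>

lemma finite_triple_product:
  fixes a b :: complex
  assumes p: "norm (a * b) < 1"
  shows "((\<lambda>k. qbinom (a * b) (2 * n) (int n + k) * theta_term a b k) has_sum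
           (\<Prod>i<n. (1 + a * (a * b) ^ i) * (1 + b * (a * b) ^ i))) UNIV"
proof (induction n)
  case 0
  have "((\<lambda>k. if k = 0 then 1 else 0 :: complex) has_sum 1) {0 :: int}"
    by (rule has_sum_finiteI) auto
  hence "((\<lambda>k. if k = 0 then 1 else 0 :: complex) has_sum 1) (UNIV :: int set)"
    by (subst has_sum_cong_neutral[where T = "{0}"]) auto
  moreover have "qbinom (a * b) 0 k * theta_term a b k = (if k = 0 then 1 else 0)" for k
    by (auto simp: qbinom_def)
  ultimately show ?case by simp
next
  case (Suc n)
  let ?p = "a * b"
  define S where "S = (\<Prod>i<n. (1 + a * ?p ^ i) * (1 + b * ?p ^ i))"
  define f where "f = (\<lambda>k. qbinom ?p (2 * n) (int n + k) * theta_term a b k)"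
  define g where "g = (\<lambda>k. qbinom ?p (Suc (2 * n)) (int n + k) * theta_term a b k)"
  have f: "(f has_sum S) UNIV" using Suc by (simp add: f_def S_def)
  have shift: "((\<lambda>k. h (k + c)) has_sum s) UNIV" if "(h has_sum s) UNIV"
    for h :: "int \<Rightarrow> complex" and c s
    using that by (subst has_sum_reindex_bij_witness[of _ "\<lambda>k. k - c" "\<lambda>k. k + c" UNIV h]) auto
  have "((\<lambda>k. f k + a * ?p ^ n * f (k - 1)) has_sum (S + a * ?p ^ n * S)) UNIV"
    using shift[OF f, of "-1"] by (intro has_sum_add has_sum_cmult_right f) auto
  moreover have "f k + a * ?p ^ n * f (k - 1) = g k" for k
  proof -
    have "a * ?p ^ n * f (k - 1) = ?p ^ nat (int (2 * n) + 1 - (int n + k)) * qbinom ?p (2 * n) (int n + k - 1) * theta_term a b k"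
    \<comment> \<open>Beyond this range the truncated exponent of the weight is meaningless, but
      there both binomial coefficients vanish.\<close>
    proof (cases "k \<le> int n + 1")
      case True
      thus ?thesis using theta_term_step_up[OF True, of a b] by (simp add: f_def algebra_simps)
    next
      case False
      thus ?thesis by (simp add: f_def qbinom_def)
    qed
    thus ?thesis unfolding g_def qbinom_Suc[OF p] by (simp add: f_def algebra_simps)
  qed
  ultimately have g: "(g has_sum (S * (1 + a * ?p ^ n))) UNIV" by (simp add: algebra_simps)
  have "((\<lambda>k. g k + b * ?p ^ n * g (k + 1)) has_sum (S * (1 + a * ?p ^ n) + b * ?p ^ n * (S * (1 + a * ?p ^ n)))) UNIV"
    using shift[OF g, of 1] by (intro has_sum_add has_sum_cmult_right g) auto
  moreover have "g k + b * ?p ^ n * g (k + 1) = qbinom ?p (2 * Suc n) (int (Suc n) + k) * theta_term a b k" for k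
  proof -
    have "b * ?p ^ n * g (k + 1) = ?p ^ nat (int (Suc n) + k) * qbinom ?p (Suc (2 * n)) (int (Suc n) + k) * theta_term a b k"
    proof (cases "- k \<le> int n + 1")
      case True
      thus ?thesis using theta_term_step_down[OF True, of b a] by (simp add: g_def algebra_simps)
    next
      case False
      thus ?thesis by (simp add: g_def qbinom_def)
    qed
    moreover have "2 * Suc n = Suc (Suc (2 * n))" by simp
    ultimately show ?thesis unfolding qbinom_Suc'[OF p] by (simp only:) (simp add: g_def qbinom_Suc'[OF p] algebra_simps)
  qed
  ultimately show ?case by (simp add: S_def algebra_simps)
qed

lemma qfact_LIMSEQ: "norm p < 1 \<Longrightarrow> qfact p \<longlonglongrightarrow> qpochhammer_inf p p"
  unfolding qfact_def by (rule qpochhammer_inf_LIMSEQ)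

text \<open>\<open>qfact p\<close> converges to a nonzero limit, so it and its inverse are bounded
  sequences. The uniform \<open>K\<close> supplies the majorant for the limit in the triple
  product.\<close>

lemma qbinom_bounded:
  assumes p: "norm p < 1"
  obtains K where "\<And>n k. norm (qbinom p n k) \<le> K"
proof -
  have nz: "qpochhammer_inf p p \<noteq> 0" using p by (intro qpochhammer_inf_nonzero)
  obtain A where A: "\<And>n. norm (qfact p n) \<le> A"
    using convergent_imp_Bseq[OF convergentI[OF qfact_LIMSEQ[OF p]]] by (auto simp: Bseq_def)
  obtain B where B: "\<And>n. norm (inverse (qfact p n)) \<le> B"
    using convergent_imp_Bseq[OF convergentI[OF tendsto_inverse[OF qfact_LIMSEQ[OF p] nz]]] by (auto simp: Bseq_def)
  have 0: "0 \<le> A" "0 \<le> B" using A[of 0] B[of 0] norm_ge_zero by (auto intro: order_trans)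
  have "norm (qbinom p n k) \<le> A * (B * B)" for n k
  proof (cases "0 \<le> k \<and> k \<le> int n")
    case True
    hence "norm (qbinom p n k) = norm (qfact p n) * (norm (inverse (qfact p (nat k))) * norm (inverse (qfact p (nat (int n - k)))))"
      by (simp add: qbinom_def norm_divide norm_mult norm_inverse field_simps)
    also have "\<dots> \<le> A * (B * B)" using 0 by (intro mult_mono A B) auto
    finally show ?thesis .
  next
    case False
    thus ?thesis using 0 by (auto simp: qbinom_def)
  qed
  thus thesis by (rule that)
qed

text \<open>Numerator and both denominator factors tend to the same product, so one factor survives
  in the denominator. The quotient formula agrees with \<open>qbinom\<close> once \<open>n\<close>
  is at least the absolute value of \<open>k\<close>.\<close>

lemma central_qbinom_LIMSEQ:
  assumes p: "norm p < 1"
  shows "(\<lambda>n. qbinom p (2 * n) (int n + k)) \<longlonglongrightarrow> inverse (qpochhammer_inf p p)"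
proof -
  let ?E = "qpochhammer_inf p p"
  have nz: "?E \<noteq> 0" using p by (intro qpochhammer_inf_nonzero)
  have "filterlim (\<lambda>n. 2 * n) at_top (sequentially :: nat filter)"
    by (intro filterlim_subseq) (auto simp: strict_mono_def)
  hence 1: "(\<lambda>n. qfact p (2 * n)) \<longlonglongrightarrow> ?E"
    by (rule filterlim_compose[OF qfact_LIMSEQ[OF p]])
  have 2: "(\<lambda>n. qfact p (nat (int n + c))) \<longlonglongrightarrow> ?E" for c
  proof (rule filterlim_compose[OF qfact_LIMSEQ[OF p]])
    show "filterlim (\<lambda>n. nat (int n + c)) at_top sequentially"
      unfolding filterlim_at_top
    proof
      fix Z :: nat
      show "\<forall>\<^sub>F n in sequentially. Z \<le> nat (int n + c)"
        using eventually_ge_at_top[of "Z + nat \<bar>c\<bar>"] by eventually_elim auto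
    qed
  qed
  have "(\<lambda>n. qfact p (2 * n) / (qfact p (nat (int n + k)) * qfact p (nat (int n + (- k))))) \<longlonglongrightarrow> ?E / (?E * ?E)"
    using nz by (intro tendsto_divide tendsto_mult 1 2) auto
  moreover have "\<forall>\<^sub>F n in sequentially. qfact p (2 * n) / (qfact p (nat (int n + k)) * qfact p (nat (int n + (- k)))) = qbinom p (2 * n) (int n + k)"
    using eventually_ge_at_top[of "nat \<bar>k\<bar>"] by eventually_elim (auto simp: qbinom_def)
  ultimately show ?thesis using nz by (auto dest: Lim_transform_eventually simp: field_simps)
qed

text \<open>Let \<open>n\<close> tend to infinity in \<open>finite_triple_product\<close>: dominated
  convergence replaces each coefficient by its limit, and the partial products converge to the
  q-Pochhammer symbols.\<close>

theorem jacobi_triple_product: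
  assumes "norm a \<le> 1" "norm b \<le> 1" and p: "norm (a * b) < 1"
  shows "theta a b = qpochhammer_inf (- a) (a * b) * qpochhammer_inf (- b) (a * b) * qpochhammer_inf (a * b) (a * b)"
proof -
  let ?p = "a * b"
  let ?E = "qpochhammer_inf ?p ?p"
  obtain K where K: "\<And>n k. norm (qbinom ?p n k) \<le> K" using qbinom_bounded[OF p] by blast
  have "(\<lambda>n. \<Sum>\<^sub>\<infinity>k. qbinom ?p (2 * n) (int n + k) * theta_term a b k) \<longlonglongrightarrow> (\<Sum>\<^sub>\<infinity>k. inverse ?E * theta_term a b k)"
  proof (rule infsum_dominated_convergence[where Y = UNIV])
    show "(\<lambda>k. K * norm (theta_term a b k)) summable_on UNIV"
      by (intro summable_on_cmult_right abs_summable_theta_term assms)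
  qed (auto intro!: tendsto_intros central_qbinom_LIMSEQ p mult_right_mono K simp: norm_mult)
  moreover have "(\<Sum>\<^sub>\<infinity>k. qbinom ?p (2 * n) (int n + k) * theta_term a b k) =
      (\<Prod>i<n. (1 - (- a) * ?p ^ i)) * (\<Prod>i<n. 1 - (- b) * ?p ^ i)" for n
    using infsumI[OF finite_triple_product[OF p, of n]] by (simp add: prod.distrib)
  moreover have "(\<lambda>n. (\<Prod>i<n. (1 - (- a) * ?p ^ i)) * (\<Prod>i<n. 1 - (- b) * ?p ^ i)) \<longlonglongrightarrow>
      qpochhammer_inf (- a) ?p * qpochhammer_inf (- b) ?p"
    by (intro tendsto_mult qpochhammer_inf_LIMSEQ p)
  ultimately have "(\<Sum>\<^sub>\<infinity>k. inverse ?E * theta_term a b k) = qpochhammer_inf (- a) ?p * qpochhammer_inf (- b) ?p"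
    using LIMSEQ_unique by auto
  hence "inverse ?E * theta a b = qpochhammer_inf (- a) ?p * qpochhammer_inf (- b) ?p"
    by (simp add: infsum_cmult_right' theta_def)
  thus ?thesis using qpochhammer_inf_nonzero[OF p p] by (simp add: field_simps)
qed

lemma theta_commute: "theta a b = theta b a"
  unfolding theta_def
  by (rule infsum_reindex_bij_witness[of _ uminus uminus]) (auto simp: theta_term_minus)

section \<open>Splitting products of theta functions modulo $2 + i$\<close>

text \<open>The map $(a,b) \mapsto (a + 2b, b - 2a)$ is multiplication by $1 - 2i$ on Gaussian integers, of
  norm 5, and $0, \pm 1, \pm i$ represent the classes modulo its image.\<close>

lemma infsum_gaussian_cosets:
  fixes g :: "int \<times> int \<Rightarrow> complex"
  assumes g: "g summable_on UNIV"
  shows "infsum g UNIV = (\<Sum>(c, d) \<in> {(0, 0), (1, 0), (-1, 0), (0, 1), (0, -1)}.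
           \<Sum>\<^sub>\<infinity>(a, b). g (a + 2 * b + c, b - 2 * a + d))"
proof -
  \<comment> \<open>The residue of \<open>x - 2 * y\<close> modulo 5 identifies the coset, since
    \<open>(a + 2 * b) - 2 * (b - 2 * a) = 5 * a\<close>. The representatives have residues 0, 1, 4,
    3, 2 in the order listed.\<close>
  define C where "C = (\<lambda>r. {z :: int \<times> int. (fst z - 2 * snd z) mod 5 = r})"
  have coset: "(\<Sum>\<^sub>\<infinity>(a, b). g (a + 2 * b + c, b - 2 * a + d)) = infsum g (C ((c - 2 * d) mod 5))" for c d
  proof (rule infsum_reindex_bij_witness[of _
        \<comment> \<open>The inverse of the linear map is \<open>(x, y)\<close> to
          \<open>((x - 2 * y) / 5, (2 * x + y) / 5)\<close>, applied after removing the shift; the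
          divisions are exact on the coset.\<close>
        "\<lambda>(x, y). ((x - c - 2 * (y - d)) div 5, (2 * (x - c) + (y - d)) div 5)"
        "\<lambda>(a, b). (a + 2 * b + c, b - 2 * a + d)"])
    fix z assume "z \<in> C ((c - 2 * d) mod 5)"
    moreover obtain x y where z: "z = (x, y)" by force
    ultimately have "5 dvd ((x - 2 * y) - (c - 2 * d))" by (simp add: C_def mod_eq_dvd_iff)
    then obtain k where k: "(x - 2 * y) - (c - 2 * d) = 5 * k" by (elim dvdE)
    have x: "x = 5 * k + c + 2 * (y - d)" using k by simp
    show "(case case z of (x, y) \<Rightarrow> ((x - c - 2 * (y - d)) div 5, (2 * (x - c) + (y - d)) div 5)
          of (a, b) \<Rightarrow> (a + 2 * b + c, b - 2 * a + d)) = z"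
      unfolding z x prod.case by simp
  next
    fix z :: "int \<times> int"
    obtain a b where z: "z = (a, b)" by force
    have "(a + 2 * b + c - 2 * (b - 2 * a + d)) mod 5 = (c - 2 * d + 5 * a) mod 5"
      by (simp add: algebra_simps)
    thus "(case z of (a, b) \<Rightarrow> (a + 2 * b + c, b - 2 * a + d)) \<in> C ((c - 2 * d) mod 5)"
      unfolding z by (simp add: C_def)
  qed auto
  have "infsum g UNIV = infsum (\<lambda>(r, z). g z) (Sigma {0..<5} C)"
    by (rule infsum_reindex_bij_witness[of _ snd "\<lambda>z. ((fst z - 2 * snd z) mod 5, z)"]) (auto simp: C_def)
  also have "\<dots> = (\<Sum>\<^sub>\<infinity>r\<in>{0..<5}. infsum g (C r))"
  proof (subst infsum_Sigma'_banach[symmetric])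
    have "g summable_on UNIV \<longleftrightarrow> (\<lambda>(r, z). g z) summable_on (Sigma {0..<5} C)"
      by (rule summable_on_reindex_bij_witness[of _ snd "\<lambda>z. ((fst z - 2 * snd z) mod 5, z)"]) (auto simp: C_def)
    thus "(\<lambda>(r, z). g z) summable_on (Sigma {0..<5} C)" using g by simp
  qed simp
  also have "{0..<5 :: int} = {0, 1, 2, 3, 4}" by auto
  finally show ?thesis unfolding coset by (simp add: add_ac)
qed

lemma theta_mult:
  assumes ab: "norm a \<le> 1" "norm b \<le> 1" "norm (a * b) < 1"
    and cd: "norm c \<le> 1" "norm d \<le> 1" "norm (c * d) < 1"
  shows "((\<lambda>(x, y). theta_term a b x * theta_term c d y) has_sum (theta a b * theta c d)) UNIV"
proof -
  let ?f = "theta_term a b" and ?g = "theta_term c d"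
  have "(\<lambda>z. norm (case z of (x, y) \<Rightarrow> ?f x * ?g y)) summable_on UNIV \<times> UNIV"
  proof (subst Infinite_Sum.abs_summable_on_Sigma_iff, intro conjI ballI)
    show "(\<lambda>y. norm (case (x, y) of (x, y) \<Rightarrow> ?f x * ?g y)) summable_on UNIV" for x
      by (auto simp: norm_mult intro!: summable_on_cmult_right abs_summable_theta_term cd)
    have "(\<lambda>x. norm (?f x) * (\<Sum>\<^sub>\<infinity>y. norm (?g y))) summable_on UNIV"
      by (intro summable_on_cmult_left abs_summable_theta_term ab)
    moreover have "0 \<le> (\<Sum>\<^sub>\<infinity>y. norm (?g y))" by (rule infsum_nonneg) auto
    ultimately show "(\<lambda>x. norm (\<Sum>\<^sub>\<infinity>y. norm (case (x, y) of (x, y) \<Rightarrow> ?f x * ?g y))) summable_on UNIV"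
      by (simp add: norm_mult infsum_cmult_right')
  qed
  hence s: "(\<lambda>(x, y). ?f x * ?g y) summable_on UNIV \<times> UNIV"
    by (rule abs_summable_summable)
  have "infsum (\<lambda>(x, y). ?f x * ?g y) (UNIV \<times> UNIV) = theta a b * theta c d"
    by (subst infsum_Sigma'_banach[OF s, symmetric])
       (simp add: infsum_cmult_right' infsum_cmult_left' theta_def)
  with s show ?thesis by (simp add: has_sum_iff)
qed

lemma infsum_theta_mult:
  assumes "norm a \<le> 1" "norm b \<le> 1" "norm (a * b) < 1"
    and "norm c \<le> 1" "norm d \<le> 1" "norm (c * d) < 1"
  shows "(\<Sum>\<^sub>\<infinity>(x, y). k * theta_term a b x * theta_term c d y) = k * theta a b * theta c d"
  using infsumI[OF has_sum_cmult_right[OF theta_mult[OF assms], of k]] by (simp add: case_prod_unfold mult.assoc)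

lemma theta_mult_gaussian_cosets:
  assumes "norm a \<le> 1" "norm b \<le> 1" "norm (a * b) < 1"
    and "norm c \<le> 1" "norm d \<le> 1" "norm (c * d) < 1"
  shows "theta a b * theta c d = (\<Sum>(u, v) \<in> {(0, 0), (1, 0), (-1, 0), (0, 1), (0, -1)}.
           \<Sum>\<^sub>\<infinity>(x, y). theta_term a b (x + 2 * y + u) * theta_term c d (y - 2 * x + v))"
  using infsum_gaussian_cosets[OF has_sum_imp_summable[OF theta_mult[OF assms]]]
    infsumI[OF theta_mult[OF assms]] by simp

text \<open>The total exponent of \<open>s\<close> is \<open>n\<close> squared, which has the parity
  of \<open>n\<close>. This separates the sign from the power of \<open>q\<close>.\<close>

lemma theta_term_signed_power:
  fixes q s :: complex
  assumes s: "s = 1 \<or> s = -1"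
  shows "theta_term (s * q ^ l) (s * q ^ m) n = s ^ nat \<bar>n\<bar> * q ^ (l * tri n + m * tri (- n))"
proof -
  have "even (int (tri n + tri (-n))) = even n"
    unfolding tri_add_tri_minus by simp
  hence "s ^ (tri n + tri (-n)) = s ^ nat \<bar>n\<bar>"
    using s by (cases "even n") (auto simp: even_nat_iff)
  moreover have "theta_term (s * q ^ l) (s * q ^ m) n = s ^ (tri n + tri (-n)) * q ^ (l * tri n + m * tri (- n))"
    by (simp add: theta_term_def power_add power_mult power_mult_distrib)
  ultimately show ?thesis by simp
qed

text \<open>Over the reals, equations between exponents become polynomial identities that
  simplification can settle.\<close>

lemma real_tri: "real (tri n) = real_of_int n * (real_of_int n + 1) / 2"
  using arg_cong[OF tri_eq[of n], of real_of_int] by simp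

lemma nat_eq_realI: "real m = real n \<Longrightarrow> m = n" by simp

lemma norm_power_le_one: "norm (q :: complex) < 1 \<Longrightarrow> norm (q ^ n) \<le> 1"
  by (simp add: norm_power power_le_one)

lemma norm_power_mult_power_less_one:
  "norm (q :: complex) < 1 \<Longrightarrow> 0 < m + n \<Longrightarrow> norm (q ^ m * q ^ n) < 1"
  unfolding power_add[symmetric] norm_power by (simp add: power_less_one_iff)

text \<open>\<open>exponents\<close> says that the quadratic form in the new variables has no cross
  term, as happens when \<open>l + m = l' + m'\<close>. The summand then separates in
  \<open>x\<close> and \<open>y\<close>, and the coset contributes a product of two theta
  functions.\<close>

lemma infsum_theta_coset:
  fixes q s :: complex
  assumes q: "norm q < 1" and s: "s = 1 \<or> s = -1" and pos: "0 < a + b" "0 < c + d"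
    and exponents: "\<And>x y. l * tri (x + 2 * y + u) + m * tri (- (x + 2 * y + u)) +
        (l' * tri (y - 2 * x + v) + m' * tri (- (y - 2 * x + v))) =
        k + (a * tri x + b * tri (- x)) + (c * tri y + d * tri (- y))"
  shows "(\<Sum>\<^sub>\<infinity>(x, y). theta_term (q ^ l) (q ^ m) (x + 2 * y + u) *
            theta_term (s * q ^ l') (s * q ^ m') (y - 2 * x + v)) =
         s ^ nat \<bar>v\<bar> * q ^ k * theta (q ^ a) (q ^ b) * theta (s * q ^ c) (s * q ^ d)"
proof -
  have ns: "norm s = 1" "s * s = 1" using s by auto
  have "(\<Sum>\<^sub>\<infinity>(x, y). theta_term (q ^ l) (q ^ m) (x + 2 * y + u) * theta_term (s * q ^ l') (s * q ^ m') (y - 2 * x + v)) =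
    (\<Sum>\<^sub>\<infinity>(x, y). (s ^ nat \<bar>v\<bar> * q ^ k) * theta_term (q ^ a) (q ^ b) x * theta_term (s * q ^ c) (s * q ^ d) y)"
  proof (intro infsum_cong, clarify)
    fix x y :: int
    \<comment> \<open>Only parity matters for the sign, and \<open>2 * x\<close> does not affect it;
      hence the theta function in \<open>x\<close> carries no sign.\<close>
    have "s ^ nat \<bar>y - 2 * x + v\<bar> = s ^ nat \<bar>v\<bar> * s ^ nat \<bar>y\<bar>"
      using s by (auto simp: minus_one_power_iff even_nat_iff)
    moreover have "q ^ (l * tri (x + 2 * y + u) + m * tri (- (x + 2 * y + u))) * q ^ (l' * tri (y - 2 * x + v) + m' * tri (- (y - 2 * x + v)))
        = q ^ k * q ^ (a * tri x + b * tri (- x)) * q ^ (c * tri y + d * tri (- y))"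
      unfolding power_add[symmetric] exponents ..
    ultimately show "theta_term (q ^ l) (q ^ m) (x + 2 * y + u) * theta_term (s * q ^ l') (s * q ^ m') (y - 2 * x + v) =
        (s ^ nat \<bar>v\<bar> * q ^ k) * theta_term (q ^ a) (q ^ b) x * theta_term (s * q ^ c) (s * q ^ d) y"
      using theta_term_signed_power[of 1 q] by (simp add: theta_term_signed_power[OF s] mult_ac)
  qed
  also have "\<dots> = s ^ nat \<bar>v\<bar> * q ^ k * theta (q ^ a) (q ^ b) * theta (s * q ^ c) (s * q ^ d)"
    using norm_power_mult_power_less_one[OF q] pos
    by (intro infsum_theta_mult)
       (simp_all add: norm_mult ns norm_power_le_one[OF q, unfolded norm_power] norm_power)
  finally show ?thesis .
qed

text \<open>The exponent is the norm form on Gaussian integers, which the map scales by 5. The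
  trivial coset therefore gives the square at \<open>q ^ 5\<close>, and by symmetry of
  \<open>theta\<close> the other four contribute equally.\<close>

lemma theta_square_cosets:
  fixes q :: complex
  assumes q: "norm q < 1"
  shows "(theta q q)\<^sup>2 = (theta (q ^ 5) (q ^ 5))\<^sup>2 + 4 * q * theta (q ^ 9) q * theta (q ^ 7) (q ^ 3)"
proof -
  define F where "F = (\<lambda>u v. \<Sum>\<^sub>\<infinity>(x, y). theta_term (q ^ 1) (q ^ 1) (x + 2 * y + u) *
    theta_term (q ^ 1) (q ^ 1) (y - 2 * x + v))"
  have F: "F u v = q ^ k * theta (q ^ a) (q ^ b) * theta (q ^ c) (q ^ d)"
    if "0 < a + b" "0 < c + d" "\<And>x y. real (tri (x + 2 * y + u) + tri (- (x + 2 * y + u)) +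
        (tri (y - 2 * x + v) + tri (- (y - 2 * x + v)))) =
        real (k + (a * tri x + b * tri (- x)) + (c * tri y + d * tri (- y)))" for u v a b c d k
    unfolding F_def using that infsum_theta_coset[OF q, of 1 a b c d 1 u 1 1 v 1 k]
    by (simp del: of_nat_add of_nat_mult)
  have "(theta q q)\<^sup>2 = (\<Sum>(u, v) \<in> {(0, 0), (1, 0), (-1, 0), (0, 1), (0, -1)}. F u v)"
    using theta_mult_gaussian_cosets[of "q ^ 1" "q ^ 1" "q ^ 1" "q ^ 1"] norm_power_le_one[OF q, of 1]
      norm_power_mult_power_less_one[OF q, of 1 1] unfolding F_def by (simp add: power2_eq_square)
  also have "\<dots> = F 0 0 + F 1 0 + F (-1) 0 + F 0 1 + F 0 (-1)" by simp
  also have "F 0 0 = q ^ 0 * theta (q ^ 5) (q ^ 5) * theta (q ^ 5) (q ^ 5)"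
    by (rule F; simp add: real_tri; simp add: field_simps)
  \<comment> \<open>The exponent is \<open>1 + (5 x^2 + 2 x) + (5 y^2 + 4 y)\<close>. Since
    \<open>a * tri x + b * tri (- x)\<close> equals \<open>(a + b)/2 x^2 + (a - b)/2 x\<close>, this
    forces the pairs 7, 3 and 9, 1. The other cosets are read off likewise.\<close>
  also have "F 1 0 = q ^ 1 * theta (q ^ 7) (q ^ 3) * theta (q ^ 9) (q ^ 1)"
    by (rule F; simp add: real_tri; simp add: field_simps)
  also have "F (-1) 0 = q ^ 1 * theta (q ^ 3) (q ^ 7) * theta (q ^ 1) (q ^ 9)"
    by (rule F; simp add: real_tri; simp add: field_simps)
  also have "F 0 1 = q ^ 1 * theta (q ^ 1) (q ^ 9) * theta (q ^ 7) (q ^ 3)"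
    by (rule F; simp add: real_tri; simp add: field_simps)
  also have "F 0 (-1) = q ^ 1 * theta (q ^ 9) (q ^ 1) * theta (q ^ 3) (q ^ 7)"
    by (rule F; simp add: real_tri; simp add: field_simps)
  finally show ?thesis
    unfolding theta_commute[of "q ^ 1" "q ^ 9"] theta_commute[of "q ^ 3" "q ^ 7"]
    by (simp add: algebra_simps power2_eq_square)
qed

section \<open>Bisection of a theta series and the identity for \<open>A + B\<close>\<close>

text \<open>Even and odd indices are summed separately. Writing the first argument as
  \<open>b * c\<close> avoids the quotient of the two arguments, which appears in the odd part as
  \<open>c\<close>.\<close>

lemma theta_bisect:
  fixes b c :: complex
  assumes b: "norm b \<le> 1" and c: "norm c \<le> 1" and bc: "norm (b * c) < 1"
  shows "theta (b * c) b = theta (b ^ 4 * c ^ 3) (b ^ 4 * c) + b * theta c (b ^ 8 * c ^ 3)"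
proof -
  let ?t = "theta_term (b * c) b"
  have le: "norm (b ^ m * c ^ n) \<le> 1" for m n
    using b c by (simp add: norm_mult norm_power power_le_one mult_le_one)
  have lt: "norm (b * c * (b ^ m * c ^ n)) < 1" for m n
  proof -
    have "norm (b * c * (b ^ m * c ^ n)) \<le> norm (b * c) * 1"
      unfolding norm_mult[of "b * c"] using le by (intro mult_left_mono) auto
    thus ?thesis using bc by simp
  qed
  have total: "(?t has_sum theta (b * c) b) UNIV"
    using le[of 1 1] b lt[of 1 0] by (intro theta_has_sum) (auto simp: mult_ac)
  have "(theta_term (b ^ 4 * c ^ 3) (b ^ 4 * c) has_sum theta (b ^ 4 * c ^ 3) (b ^ 4 * c)) UNIV"
    using le[of 4 3] le[of 4 1] lt[of 7 3] by (intro theta_has_sum) (auto simp: mult_ac eval_nat_numeral)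
  hence "(?t has_sum theta (b ^ 4 * c ^ 3) (b ^ 4 * c)) {n. even n}"
  proof (subst has_sum_reindex_bij_witness[of _ "\<lambda>n. 2 * n" "\<lambda>n. n div 2" UNIV "theta_term (b ^ 4 * c ^ 3) (b ^ 4 * c)"])
    fix n :: int assume "n \<in> {n. even n}"
    then obtain m where n: "n = 2 * m" by auto
    have "tri (2 * m) = 3 * tri m + tri (- m)" "tri (2 * m) + tri (- (2 * m)) = 4 * tri m + 4 * tri (- m)"
      by (rule nat_eq_realI; simp add: real_tri; simp add: field_simps)+
    moreover have "?t n = b ^ (tri (2 * m) + tri (- (2 * m))) * c ^ tri (2 * m)"
      by (simp add: theta_term_def n power_mult_distrib power_add)
    ultimately have "?t n = b ^ (4 * tri m + 4 * tri (- m)) * c ^ (3 * tri m + tri (- m))"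
      by (simp only:)
    also have "\<dots> = theta_term (b ^ 4 * c ^ 3) (b ^ 4 * c) (n div 2)"
      by (simp add: theta_term_def n power_mult_distrib power_add mult_ac flip: power_mult)
    finally show "theta_term (b ^ 4 * c ^ 3) (b ^ 4 * c) (n div 2) = ?t n" by (rule sym)
  qed auto
  moreover have "((\<lambda>n. b * theta_term c (b ^ 8 * c ^ 3) n) has_sum b * theta c (b ^ 8 * c ^ 3)) UNIV"
    using le[of 8 3] c lt[of 7 3] by (intro has_sum_cmult_right theta_has_sum) (auto simp: mult_ac eval_nat_numeral)
  hence "(?t has_sum b * theta c (b ^ 8 * c ^ 3)) {n. odd n}"
  \<comment> \<open>Odd indices are written \<open>2 * m - 1\<close>, so that \<open>m = 0\<close>
    is the index -1, whose term is exactly the prefactor \<open>b\<close>.\<close>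
  proof (subst has_sum_reindex_bij_witness[of _ "\<lambda>n. 2 * n - 1" "\<lambda>n. (n + 1) div 2" UNIV "\<lambda>n. b * theta_term c (b ^ 8 * c ^ 3) n"])
    fix n :: int assume "n \<in> {n. odd n}"
    hence "even (n + 1)" by simp
    then obtain m where "n + 1 = 2 * m" by (elim evenE)
    hence n: "n = 2 * m - 1" by simp
    have "tri (2 * m - 1) = tri m + 3 * tri (- m)" "tri (2 * m - 1) + tri (- (2 * m - 1)) = 1 + 8 * tri (- m)"
      by (rule nat_eq_realI; simp add: real_tri; simp add: field_simps)+
    moreover have "?t n = b ^ (tri (2 * m - 1) + tri (- (2 * m - 1))) * c ^ tri (2 * m - 1)"
      by (simp add: theta_term_def n power_mult_distrib power_add)
    ultimately have "?t n = b ^ (1 + 8 * tri (- m)) * c ^ (tri m + 3 * tri (- m))"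
      by (simp only:)
    also have "\<dots> = b * theta_term c (b ^ 8 * c ^ 3) ((n + 1) div 2)"
      by (simp add: theta_term_def n power_mult_distrib power_add mult_ac flip: power_mult)
    finally show "b * theta_term c (b ^ 8 * c ^ 3) ((n + 1) div 2) = ?t n" by (rule sym)
  qed (auto elim!: oddE)
  ultimately have "(?t has_sum (theta (b ^ 4 * c ^ 3) (b ^ 4 * c) + b * theta c (b ^ 8 * c ^ 3))) ({n. even n} \<union> {n. odd n})"
    by (intro has_sum_Un_disjoint) auto
  moreover have "{n. even n} \<union> {n. odd n} = (UNIV :: int set)" by auto
  ultimately show ?thesis by (simp add: has_sum_unique[OF total])
qed

text \<open>In the triple product the factor with index 0 is \<open>1 - 1\<close>. This disposes of
  one coset in \<open>theta_psi_phi_cosets\<close>.\<close>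

lemma theta_minus_one_right:
  assumes "norm a < 1"
  shows "theta a (- 1) = 0"
proof -
  have "(\<lambda>n. \<Prod>i<n. 1 - 1 * (- a) ^ i) \<longlonglongrightarrow> qpochhammer_inf 1 (- a)"
    using assms by (intro qpochhammer_inf_LIMSEQ) auto
  moreover have "\<forall>\<^sub>F n in sequentially. (\<Prod>i<n. 1 - 1 * (- a) ^ i) = 0"
    using eventually_gt_at_top[of 0] by eventually_elim (auto intro!: bexI[of _ 0])
  ultimately have "qpochhammer_inf 1 (- a) = 0"
    by (rule LIMSEQ_unique[OF _ tendsto_eventually])
  thus ?thesis using jacobi_triple_product[of a "-1"] assms by simp
qed

text \<open>Both factors on the left have exponents summing to 4, so the cross terms cancel on each
  coset. One coset vanishes; the other four pair up by a common signed theta factor, and bisection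
  read backwards merges each pair.\<close>

lemma theta_psi_phi_cosets:
  fixes q :: complex
  assumes q: "norm q < 1"
  shows "theta (q ^ 3) q * theta (- (q ^ 2)) (- (q ^ 2)) =
    theta (- (q ^ 3)) (- (q ^ 2)) * theta (- (q ^ 12)) (- (q ^ 8)) +
    q * theta (- (q ^ 4)) (- q) * theta (- (q ^ 16)) (- (q ^ 4))"
proof -
  define F where "F = (\<lambda>u v. \<Sum>\<^sub>\<infinity>(x, y). theta_term (q ^ 3) (q ^ 1) (x + 2 * y + u) *
    theta_term (- (q ^ 2)) (- (q ^ 2)) (y - 2 * x + v))"
  have F: "F u v = (-1) ^ nat \<bar>v\<bar> * q ^ k * theta (q ^ a) (q ^ b) * theta (- (q ^ c)) (- (q ^ d))"
    if "0 < a + b" "0 < c + d" "\<And>x y. real (3 * tri (x + 2 * y + u) + tri (- (x + 2 * y + u)) +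
        (2 * tri (y - 2 * x + v) + 2 * tri (- (y - 2 * x + v)))) =
        real (k + (a * tri x + b * tri (- x)) + (c * tri y + d * tri (- y)))" for u v a b c d k
    unfolding F_def using that infsum_theta_coset[OF q, of "-1" a b c d 3 u 1 2 v 2 k]
    by (simp del: of_nat_add of_nat_mult)
  have "theta (q ^ 3) q * theta (- (q ^ 2)) (- (q ^ 2)) = (\<Sum>(u, v) \<in> {(0, 0), (1, 0), (-1, 0), (0, 1), (0, -1)}. F u v)"
    using theta_mult_gaussian_cosets[of "q ^ 3" "q ^ 1" "- (q ^ 2)" "- (q ^ 2)"]
      norm_power_le_one[OF q, of 1] norm_power_le_one[OF q, of 2] norm_power_le_one[OF q, of 3]
      norm_power_mult_power_less_one[OF q, of 3 1] norm_power_mult_power_less_one[OF q, of 2 2]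
    unfolding F_def by simp
  also have "\<dots> = F 0 0 + F 1 0 + F (-1) 0 + F 0 1 + F 0 (-1)" by simp
  also have "F 0 0 = (-1) ^ nat \<bar>0\<bar> * q ^ 0 * theta (q ^ 11) (q ^ 9) * theta (- (q ^ 12)) (- (q ^ 8))"
    by (rule F; simp add: real_tri; simp add: field_simps)
  also have "F 1 0 = (-1) ^ nat \<bar>0\<bar> * q ^ 3 * theta (q ^ 15) (q ^ 5) * theta (- (q ^ 20)) (- (q ^ 0))"
    by (rule F; simp add: real_tri; simp add: field_simps)
  also have "F (-1) 0 = (-1) ^ nat \<bar>0\<bar> * q ^ 1 * theta (q ^ 7) (q ^ 13) * theta (- (q ^ 4)) (- (q ^ 16))"
    by (rule F; simp add: real_tri; simp add: field_simps)
  also have "F 0 1 = (-1) ^ nat \<bar>1\<bar> * q ^ 2 * theta (q ^ 3) (q ^ 17) * theta (- (q ^ 16)) (- (q ^ 4))"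
    by (rule F; simp add: real_tri; simp add: field_simps)
  also have "F 0 (-1) = (-1) ^ nat \<bar>-1\<bar> * q ^ 2 * theta (q ^ 19) (q ^ 1) * theta (- (q ^ 8)) (- (q ^ 12))"
    by (rule F; simp add: real_tri; simp add: field_simps)
  also have "theta (- (q ^ 20)) (- (q ^ 0)) = 0"
    using theta_minus_one_right[of "- (q ^ 20)"] norm_power_mult_power_less_one[OF q, of 20 0] by simp
  finally have *: "theta (q ^ 3) q * theta (- (q ^ 2)) (- (q ^ 2)) =
      (theta (q ^ 11) (q ^ 9) - q ^ 2 * theta q (q ^ 19)) * theta (- (q ^ 12)) (- (q ^ 8)) +
      q * (theta (q ^ 13) (q ^ 7) - q * theta (q ^ 3) (q ^ 17)) * theta (- (q ^ 16)) (- (q ^ 4))"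
    unfolding theta_commute[of "q ^ 7" "q ^ 13"] theta_commute[of "- (q ^ 4)" "- (q ^ 16)"]
      theta_commute[of "- (q ^ 8)" "- (q ^ 12)"] theta_commute[of "q ^ 19" "q ^ 1"]
    by (simp add: algebra_simps power2_eq_square)
  \<comment> \<open>Bisection with \<open>b = - (q ^ 2)\<close> and \<open>c = q\<close>; the
    companion identity below takes \<open>b = - q\<close> and \<open>c = q ^ 3\<close>.\<close>
  have "theta (- (q ^ 3)) (- (q ^ 2)) = theta (q ^ 11) (q ^ 9) - q ^ 2 * theta q (q ^ 19)"
  proof -
    have "- (q ^ 2) * q = - (q ^ 3)" "(- (q ^ 2)) ^ 4 * q ^ 3 = q ^ 11" "(- (q ^ 2)) ^ 4 * q = q ^ 9"
      "(- (q ^ 2)) ^ 8 * q ^ 3 = q ^ 19" by (simp_all add: eval_nat_numeral)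
    thus ?thesis
      using theta_bisect[of "- (q ^ 2)" q] q norm_power_le_one[OF q, of 2]
        norm_power_mult_power_less_one[OF q, of 3 0] by simp
  qed
  moreover have "theta (- (q ^ 4)) (- q) = theta (q ^ 13) (q ^ 7) - q * theta (q ^ 3) (q ^ 17)"
  proof -
    have "- q * q ^ 3 = - (q ^ 4)" "(- q) ^ 4 * (q ^ 3) ^ 3 = q ^ 13" "(- q) ^ 4 * q ^ 3 = q ^ 7"
      "(- q) ^ 8 * (q ^ 3) ^ 3 = q ^ 17" by (simp_all add: eval_nat_numeral)
    thus ?thesis
      using theta_bisect[of "- q" "q ^ 3"] q norm_power_le_one[OF q, of 3]
        norm_power_mult_power_less_one[OF q, of 4 0] by simp
  qed
  ultimately show ?thesis using * by simp
qed

section \<open>Product manipulations and conclusion\<close>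

text \<open>Factors are grouped by their index modulo \<open>m\<close>: the regrouping is done on
  partial products of length \<open>n * m\<close>, then \<open>n\<close> tends to infinity.\<close>

lemma qpochhammer_inf_split:
  assumes q: "norm q < 1" and m: "0 < m"
  shows "qpochhammer_inf a q = (\<Prod>j<m. qpochhammer_inf (a * q ^ j) (q ^ m))"
proof -
  have "filterlim (\<lambda>n. n * m) at_top (sequentially :: nat filter)"
    using m by (intro filterlim_subseq) (auto simp: strict_mono_def)
  hence "(\<lambda>n. \<Prod>i<n * m. 1 - a * q ^ i) \<longlonglongrightarrow> qpochhammer_inf a q"
    by (rule filterlim_compose[OF qpochhammer_inf_LIMSEQ[OF q]])
  moreover have "(\<Prod>i<n * m. 1 - a * q ^ i) = (\<Prod>j<m. \<Prod>i<n. 1 - a * q ^ j * (q ^ m) ^ i)" for n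
  proof -
    have "(\<Prod>i<n * m. 1 - a * q ^ i) = (\<Prod>i<n. \<Prod>j\<in>{i * m..<i * m + m}. 1 - a * q ^ j)"
      by (rule prod.nat_group[symmetric])
    also have "\<dots> = (\<Prod>i<n. \<Prod>j<m. 1 - a * q ^ j * (q ^ m) ^ i)"
    proof (rule prod.cong[OF refl])
      fix i
      show "(\<Prod>j\<in>{i * m..<i * m + m}. 1 - a * q ^ j) = (\<Prod>j<m. 1 - a * q ^ j * (q ^ m) ^ i)"
        by (rule prod.reindex_bij_witness[of _ "\<lambda>j. i * m + j" "\<lambda>j. j - i * m"])
           (auto simp: power_add[symmetric] power_mult[symmetric] mult.assoc mult.commute)
    qed
    also have "\<dots> = (\<Prod>j<m. \<Prod>i<n. 1 - a * q ^ j * (q ^ m) ^ i)" by (rule prod.swap)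
    finally show ?thesis .
  qed
  moreover have "(\<lambda>n. \<Prod>j<m. \<Prod>i<n. 1 - a * q ^ j * (q ^ m) ^ i) \<longlonglongrightarrow> (\<Prod>j<m. qpochhammer_inf (a * q ^ j) (q ^ m))"
    using q m by (intro tendsto_prod qpochhammer_inf_LIMSEQ) (auto simp: norm_power power_less_one_iff)
  ultimately show ?thesis using LIMSEQ_unique by auto
qed

lemma qpochhammer_inf_mult_minus:
  assumes q: "norm q < 1"
  shows "qpochhammer_inf a q * qpochhammer_inf (- a) q = qpochhammer_inf (a ^ 2) (q ^ 2)"
proof -
  have "qpochhammer_inf a q * qpochhammer_inf (- a) q = (\<Prod>i. (1 - a * q ^ i) * (1 - (- a) * q ^ i))"
    unfolding qpochhammer_inf_def by (intro prodinf_mult convergent_prod_qpochhammer q)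
  also have "(\<lambda>i. (1 - a * q ^ i) * (1 - (- a) * q ^ i)) = (\<lambda>i. 1 - a ^ 2 * (q ^ 2) ^ i)"
    by (auto simp: algebra_simps power2_eq_square power_mult_distrib)
  finally show ?thesis unfolding qpochhammer_inf_def .
qed

lemma qpochhammer_inf_power_split:
  assumes q: "norm q < 1" and "0 < m" "0 < r"
  shows "qpochhammer_inf (q ^ k) (q ^ m) = (\<Prod>j<r. qpochhammer_inf (q ^ (k + m * j)) (q ^ (m * r)))"
    and "qpochhammer_inf (- (q ^ k)) (q ^ m) = (\<Prod>j<r. qpochhammer_inf (- (q ^ (k + m * j))) (q ^ (m * r)))"
  using qpochhammer_inf_split[of "q ^ m" r] assms
  by (simp_all add: norm_power power_less_one_iff power_add power_mult)

lemma qpochhammer_inf_power_mult_minus: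
  assumes q: "norm q < 1" and "0 < m"
  shows "qpochhammer_inf (q ^ k) (q ^ m) * qpochhammer_inf (- (q ^ k)) (q ^ m) =
    qpochhammer_inf (q ^ (2 * k)) (q ^ (2 * m))"
  using qpochhammer_inf_mult_minus[of "q ^ m" "q ^ k"] assms
  by (simp add: norm_power power_less_one_iff mult.commute[of 2] flip: power_mult)

lemma theta_power_product:
  assumes q: "norm q < 1" and "0 < k + m"
  shows "theta (q ^ k) (q ^ m) = qpochhammer_inf (- (q ^ k)) (q ^ (k + m)) *
      qpochhammer_inf (- (q ^ m)) (q ^ (k + m)) * qpochhammer_inf (q ^ (k + m)) (q ^ (k + m))"
    and "theta (- (q ^ k)) (- (q ^ m)) = qpochhammer_inf (q ^ k) (q ^ (k + m)) *
      qpochhammer_inf (q ^ m) (q ^ (k + m)) * qpochhammer_inf (q ^ (k + m)) (q ^ (k + m))"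
  using jacobi_triple_product[of "q ^ k" "q ^ m"] jacobi_triple_product[of "- (q ^ k)" "- (q ^ m)"]
    norm_power_le_one[OF q] norm_power_mult_power_less_one[OF assms]
  by (simp_all add: power_add)

section \<open>Nonvanishing and continuity of theta functions, and the series of squares\<close>

lemma theta_nonzero:
  assumes "norm a < 1" "norm b < 1"
  shows "theta a b \<noteq> 0"
proof -
  have "norm (a * b) < 1"
    using assms mult_strict_mono'[of "norm a" 1 "norm b" 1] by (simp add: norm_mult)
  thus ?thesis using assms by (simp add: jacobi_triple_product qpochhammer_inf_nonzero)
qed

lemma theta_0_0 [simp]: "theta 0 0 = 1"
  by (simp add: jacobi_triple_product qpochhammer_inf_def)

text \<open>The bound \<open>r\<close> on the product of the arguments gives one geometric majorant
  on all of \<open>S\<close>, so the series converges uniformly.\<close>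

lemma continuous_on_theta:
  assumes "continuous_on S f" "continuous_on S g"
    and "\<And>x. x \<in> S \<Longrightarrow> norm (f x) \<le> 1" "\<And>x. x \<in> S \<Longrightarrow> norm (g x) \<le> 1"
    and "\<And>x. x \<in> S \<Longrightarrow> norm (f x * g x) \<le> r" and r: "0 \<le> r" "r < 1"
  shows "continuous_on S (\<lambda>x. theta (f x) (g x))"
proof (rule uniform_limit_theorem)
  show "uniform_limit S (\<lambda>N x. \<Sum>n\<in>N. theta_term (f x) (g x) n) (\<lambda>x. theta (f x) (g x)) (finite_subsets_at_top UNIV)"
    unfolding theta_def
    by (rule Weierstrass_m_test_general[OF _ summable_on_power_abs_int[OF r]])
       (use assms in \<open>blast intro: norm_theta_term_le\<close>)
  show "\<forall>\<^sub>F N in finite_subsets_at_top UNIV. continuous_on S (\<lambda>x. \<Sum>n\<in>N. theta_term (f x) (g x) n)"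
    unfolding theta_term_def using assms by (intro always_eventually allI continuous_intros)
qed simp

text \<open>The two-sided series is symmetric in \<open>n\<close>; removing the term 1 at 0 leaves
  two equal halves.\<close>

lemma sums_power_squares:
  assumes q: "norm q < 1"
  shows "(\<lambda>n. q ^ (Suc n)\<^sup>2) sums ((theta q q - 1) / 2)"
proof -
  have t: "theta_term q q n = q ^ nat (n\<^sup>2)" for n
  proof -
    have "nat (n\<^sup>2) = tri n + tri (- n)" using tri_add_tri_minus[of n] by simp
    thus ?thesis by (simp add: theta_term_def power_add)
  qed
  have total: "(theta_term q q has_sum theta q q) UNIV"
    using norm_power_mult_power_less_one[OF q, of 1 1] q by (intro theta_has_sum) auto
  define s where "s = infsum (theta_term q q) {0<..}"
  have pos: "(theta_term q q has_sum s) {0<..}"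
    unfolding s_def using has_sum_imp_summable[OF total] summable_on_subset_banach has_sum_infsum by blast
  hence neg: "(theta_term q q has_sum s) {..<0}"
    by (subst has_sum_reindex_bij_witness[of _ uminus uminus "{0<..}" "theta_term q q"])
       (auto simp: theta_term_minus)
  have "(theta_term q q has_sum 1) {0}" by (intro has_sum_finiteI) auto
  hence "(theta_term q q has_sum (1 + s + s)) ({0} \<union> {0<..} \<union> {..<0})"
    using pos neg by (intro has_sum_Un_disjoint) auto
  moreover have "{0} \<union> {0<..} \<union> {..<0} = (UNIV :: int set)" by auto
  ultimately have "theta q q = 1 + s + s" using has_sum_unique[OF total] by simp
  moreover have "((\<lambda>n. q ^ (Suc n)\<^sup>2) has_sum s) UNIV"
    using pos
  proof (subst has_sum_reindex_bij_witness[of _ "\<lambda>n. nat n - 1" "\<lambda>n. int (Suc n)" "{0<..}" "theta_term q q"])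
    fix n show "theta_term q q (int (Suc n)) = q ^ (Suc n)\<^sup>2"
      unfolding t by (simp only: of_nat_power[symmetric] nat_int)
  qed auto
  ultimately show ?thesis using has_sum_imp_sums by (simp add: field_simps)
qed

text \<open>In the notation of the introduction these are the equality of the two theta products for
  \<open>A + B\<close>, the formula for \<open>A * B\<close> without its factor \<open>q\<close>,
  and the product for \<open>A\<close> over psi in cross-multiplied form. Each follows by expanding
  with the triple product and regrouping residue classes.\<close>

lemma theta_products:
  fixes q :: complex
  assumes q: "norm q < 1"
  shows "theta (q ^ 3) q * theta (- (q ^ 2)) (- (q ^ 2)) = theta q q * theta (- (q ^ 3)) (- q)"
    and "(theta (- (q ^ 3)) (- (q ^ 2)) * theta (- (q ^ 12)) (- (q ^ 8))) * (theta (- (q ^ 4)) (- q) * theta (- (q ^ 16)) (- (q ^ 4)))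
       = theta (q ^ 9) q * theta (q ^ 7) (q ^ 3) * (theta (- (q ^ 3)) (- q))\<^sup>2"
    and "theta (- (q ^ 3)) (- (q ^ 2)) * theta (- (q ^ 12)) (- (q ^ 8)) *
         (qpochhammer_inf q (q ^ 5) * qpochhammer_inf (q ^ 4) (q ^ 5)) =
       theta (- (q ^ 3)) (- q) *
         (qpochhammer_inf (q ^ 2) (q ^ 10) * qpochhammer_inf (q ^ 8) (q ^ 10) * qpochhammer_inf (q ^ 10) (q ^ 10) *
          (qpochhammer_inf (q ^ 6) (q ^ 20) * qpochhammer_inf (q ^ 14) (q ^ 20)))"
proof -
  define P where "P = (\<lambda>k m. qpochhammer_inf (q ^ k) (q ^ m))"
  define N where "N = (\<lambda>k m. qpochhammer_inf (- (q ^ k)) (q ^ m))"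
  have nz: "P k m \<noteq> 0" "N k m \<noteq> 0" if "0 < k" "0 < m" for k m
    unfolding P_def N_def using q that by (simp_all add: qpochhammer_inf_nonzero norm_power power_less_one_iff)
  have folds: "qpochhammer_inf (q ^ k) (q ^ m) = P k m" "qpochhammer_inf (- (q ^ k)) (q ^ m) = N k m" for k m
    by (simp_all add: P_def N_def)
  note split = qpochhammer_inf_power_split[OF q, unfolded folds]
  note sq = qpochhammer_inf_power_mult_minus[OF q, unfolded folds]
  note th = theta_power_product[OF q, unfolded folds]
  have two: "P k m = P k (2 * m) * P (k + m) (2 * m)" "N k m = N k (2 * m) * N (k + m) (2 * m)" if "0 < m" for k m
    using split[of m 2 k] that by (simp_all add: lessThan_nat_numeral mult_ac)
  have five: "P k m = P k (5 * m) * P (k + m) (5 * m) * P (k + 2 * m) (5 * m) * P (k + 3 * m) (5 * m) * P (k + 4 * m) (5 * m)"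
    "N k m = N k (5 * m) * N (k + m) (5 * m) * N (k + 2 * m) (5 * m) * N (k + 3 * m) (5 * m) * N (k + 4 * m) (5 * m)"
    if "0 < m" for k m
    using split[of m 5 k] that by (simp_all add: lessThan_nat_numeral mult_ac)
  have P12: "P 1 2 = P 1 4 * P 3 4" and N12: "N 1 2 = N 1 4 * N 3 4" and P22: "P 2 2 = P 2 4 * P 4 4"
    and P11: "P 1 1 = P 1 2 * P 2 2" and P55: "P 5 5 = P 5 10 * P 10 10" and P10: "P 10 10 = P 10 20 * P 20 20"
    and P4: "P 4 10 = P 4 20 * P 14 20" and P6: "P 6 10 = P 6 20 * P 16 20"
    using two[of 2 1] two[of 2 2] two[of 1 1] two[of 5 5] two[of 10 10] two[of 10 4] two[of 10 6]
    by (simp_all add: numeral_2_eq_2[symmetric])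
  have P11': "P 1 1 = P 1 5 * P 2 5 * P 3 5 * P 4 5 * P 5 5"
    and P44: "P 4 4 = P 4 20 * P 8 20 * P 12 20 * P 16 20 * P 20 20"
    and N12': "N 1 2 = N 1 10 * N 3 10 * N 5 10 * N 7 10 * N 9 10"
    and P22': "P 2 2 = P 2 10 * P 4 10 * P 6 10 * P 8 10 * P 10 10"
    using five[of 1 1] five[of 4 4] five[of 2 1] five[of 2 2]
    by (simp_all add: numeral_2_eq_2[symmetric])
  have sq1: "P 1 2 * N 1 2 = P 2 4" and sq5: "P 5 10 * N 5 10 = P 10 20"
    using sq[of 2 1] sq[of 10 5] by simp_all
  have phi: "theta q q = N 1 2 * N 1 2 * P 2 2"
    and psi: "theta (q ^ 3) q = N 1 2 * P 4 4"
    and psi': "theta (- (q ^ 3)) (- q) = P 1 2 * P 4 4"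
    and phi2: "theta (- (q ^ 2)) (- (q ^ 2)) = P 2 4 * P 2 4 * P 4 4"
    and t32: "theta (- (q ^ 3)) (- (q ^ 2)) = P 3 5 * P 2 5 * P 5 5"
    and t41: "theta (- (q ^ 4)) (- q) = P 4 5 * P 1 5 * P 5 5"
    and t128: "theta (- (q ^ 12)) (- (q ^ 8)) = P 12 20 * P 8 20 * P 20 20"
    and t164: "theta (- (q ^ 16)) (- (q ^ 4)) = P 16 20 * P 4 20 * P 20 20"
    and t91: "theta (q ^ 9) q = N 9 10 * N 1 10 * P 10 10"
    and t73: "theta (q ^ 7) (q ^ 3) = N 7 10 * N 3 10 * P 10 10"
    using th(1)[of 1 1] th(1)[of 3 1] th(2)[of 3 1] th(2)[of 2 2] th(2)[of 3 2] th(2)[of 4 1]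
      th(2)[of 12 8] th(2)[of 16 4] th(1)[of 9 1] th(1)[of 7 3] P12 N12
    by (simp_all add: numeral_2_eq_2[symmetric] mult_ac)
  show "theta (q ^ 3) q * theta (- (q ^ 2)) (- (q ^ 2)) = theta q q * theta (- (q ^ 3)) (- q)"
    unfolding phi psi psi' phi2 P22 sq1[symmetric] by (simp only: mult_ac)
  \<comment> \<open>The auxiliary factor \<open>N 5 10\<close> completes the classes 1, 3, 7, 9
    modulo 10 to \<open>N 1 2\<close> on the right, and turns \<open>P 5 10\<close> into
    \<open>P 10 20\<close> on the left. It is nonzero and is cancelled at the end.\<close>
  have "(P 3 5 * P 2 5 * P 5 5) * (P 12 20 * P 8 20 * P 20 20) * ((P 4 5 * P 1 5 * P 5 5) * (P 16 20 * P 4 20 * P 20 20)) * N 5 10 =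
      P 1 1 * P 4 4 * (P 5 5 * N 5 10) * P 20 20"
    unfolding P11' P44 by (simp only: mult_ac)
  also have "\<dots> = P 1 1 * P 4 4 * (P 10 10 * P 10 10)"
    using sq5 unfolding P55 P10 by (simp add: mult_ac)
  also have "\<dots> = (N 9 10 * N 1 10 * P 10 10) * (N 7 10 * N 3 10 * P 10 10) * (P 1 2 * P 4 4)\<^sup>2 * N 5 10"
  proof -
    have "P 1 1 * P 4 4 = P 1 2 * (P 1 2 * N 1 2) * P 4 4 * P 4 4" unfolding P11 P22 sq1 by (simp only: mult_ac)
    thus ?thesis unfolding N12' power2_eq_square by (simp only: mult_ac)
  qed
  finally show "(theta (- (q ^ 3)) (- (q ^ 2)) * theta (- (q ^ 12)) (- (q ^ 8))) * (theta (- (q ^ 4)) (- q) * theta (- (q ^ 16)) (- (q ^ 4)))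
       = theta (q ^ 9) q * theta (q ^ 7) (q ^ 3) * (theta (- (q ^ 3)) (- q))\<^sup>2"
    unfolding t32 t41 t128 t164 t91 t73 psi' using nz(2)[of 5 10] by (metis mult_right_cancel zero_less_numeral)
  \<comment> \<open>The denominator of the theorem supplies the missing classes modulo 5. Afterwards
    \<open>P 4 10\<close> and \<open>P 6 10\<close> are split modulo 20 to release
    \<open>P 4 20\<close> and \<open>P 16 20\<close>, which complete \<open>P 4 4\<close>.\<close>
  have "(P 3 5 * P 2 5 * P 5 5) * (P 12 20 * P 8 20 * P 20 20) * (P 1 5 * P 4 5) = P 1 1 * (P 12 20 * P 8 20 * P 20 20)"
    unfolding P11' by (simp only: mult_ac)
  also have "\<dots> = P 1 2 * P 4 4 * (P 2 10 * P 8 10 * P 10 10 * (P 6 20 * P 14 20))"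
    unfolding P11 P22' P4 P6 P44 by (simp only: mult_ac)
  finally show "theta (- (q ^ 3)) (- (q ^ 2)) * theta (- (q ^ 12)) (- (q ^ 8)) *
         (qpochhammer_inf q (q ^ 5) * qpochhammer_inf (q ^ 4) (q ^ 5)) =
       theta (- (q ^ 3)) (- q) *
         (qpochhammer_inf (q ^ 2) (q ^ 10) * qpochhammer_inf (q ^ 8) (q ^ 10) * qpochhammer_inf (q ^ 10) (q ^ 10) *
          (qpochhammer_inf (q ^ 6) (q ^ 20) * qpochhammer_inf (q ^ 14) (q ^ 20)))"
    unfolding t32 t128 psi' by (simp add: P_def)
qed

text \<open>The squares of both sides agree by the two coset identities; since the right-hand side has no
  zeros in the unit disc, the sign is constant there and is read off at 0.\<close>

lemma theta_difference:
  fixes q :: complex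
  assumes q: "norm q < 1"
  shows "theta (- (q ^ 3)) (- (q ^ 2)) * theta (- (q ^ 12)) (- (q ^ 8)) -
      q * theta (- (q ^ 4)) (- q) * theta (- (q ^ 16)) (- (q ^ 4)) =
    theta (q ^ 5) (q ^ 5) * theta (- (q ^ 3)) (- q)"
proof -
  define A where "A = (\<lambda>q. theta (- (q ^ 3)) (- (q ^ 2)) * theta (- (q ^ 12)) (- (q ^ 8)))"
  define B where "B = (\<lambda>q. q * theta (- (q ^ 4)) (- q) * theta (- (q ^ 16)) (- (q ^ 4)))"
  define C where "C = (\<lambda>q. theta (q ^ 5) (q ^ 5) * theta (- (q ^ 3)) (- q))"
  have lt: "norm (z ^ n) < 1" if "norm z < 1" "0 < n" for z :: complex and n
    using that by (simp add: norm_power power_less_one_iff)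
  have C_nz: "C z \<noteq> 0" if "norm z < 1" for z
    unfolding C_def using that lt[OF that] by (simp add: theta_nonzero)
  have sq: "(A z - B z)\<^sup>2 = (C z)\<^sup>2" if z: "norm z < 1" for z
  proof -
    have sum: "A z + B z = theta z z * theta (- (z ^ 3)) (- z)"
      unfolding A_def B_def using theta_psi_phi_cosets[OF z] theta_products(1)[OF z] by simp
    have prod: "A z * B z = z * theta (z ^ 9) z * theta (z ^ 7) (z ^ 3) * (theta (- (z ^ 3)) (- z))\<^sup>2"
      unfolding A_def B_def using theta_products(2)[OF z] by (simp add: mult_ac)
    have "(A z - B z)\<^sup>2 = (A z + B z)\<^sup>2 - 4 * (A z * B z)"
      by (simp add: power2_eq_square algebra_simps)
    also have "\<dots> = ((theta z z)\<^sup>2 - 4 * z * theta (z ^ 9) z * theta (z ^ 7) (z ^ 3)) * (theta (- (z ^ 3)) (- z))\<^sup>2"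
      unfolding sum prod by (simp add: power_mult_distrib algebra_simps)
    also have "\<dots> = (C z)\<^sup>2"
      unfolding theta_square_cosets[OF z] C_def by (simp add: power_mult_distrib)
    finally show ?thesis .
  qed
  \<comment> \<open>On this closed disc \<open>norm q\<close> itself serves as the uniform bound
    \<open>r\<close>, because \<open>k + m\<close> is at least 1.\<close>
  have th: "continuous_on (cball 0 (norm q)) (\<lambda>z. theta (s * z ^ k) (s * z ^ m))"
    if s: "s = 1 \<or> s = -1" and km: "0 < k + m" for s k m
  proof (rule continuous_on_theta)
    fix z :: complex assume "z \<in> cball 0 (norm q)"
    hence z: "norm z \<le> norm q" by simp
    have s1: "norm s = 1" using s by auto
    show "norm (s * z ^ k) \<le> 1" "norm (s * z ^ m) \<le> 1"
      using z q s1 by (auto simp: norm_mult norm_power power_le_one)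
    have "norm (s * z ^ k * (s * z ^ m)) = norm z ^ (k + m)"
      by (simp add: norm_mult norm_power s1 power_add)
    also have "\<dots> \<le> norm z ^ 1" using z q km by (intro power_decreasing) auto
    finally show "norm (s * z ^ k * (s * z ^ m)) \<le> norm q" using z by simp
  qed (use q in \<open>auto intro!: continuous_intros\<close>)
  have cont_minus: "continuous_on (cball 0 (norm q)) (\<lambda>z. theta (- (z ^ k)) (- (z ^ m)))" if "0 < k + m" for k m
    using th[of "-1" k m] that by simp
  have cont_plus: "continuous_on (cball 0 (norm q)) (\<lambda>z. theta (z ^ k) (z ^ m))" if "0 < k + m" for k m
    using th[of 1 k m] that by simp
  have cont: "continuous_on (cball 0 (norm q)) (\<lambda>z. (A z - B z) / C z)"
  proof (intro continuous_intros)
    show "continuous_on (cball 0 (norm q)) A" "continuous_on (cball 0 (norm q)) B" "continuous_on (cball 0 (norm q)) C"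
      unfolding A_def B_def C_def using cont_minus[of 4 1] cont_minus[of 3 1]
      by (intro continuous_intros cont_minus cont_plus; simp)+
    show "\<forall>z\<in>cball 0 (norm q). C z \<noteq> 0" using C_nz q by auto
  qed
  have pm: "(A z - B z) / C z \<in> {1, -1}" if "z \<in> cball 0 (norm q)" for z
  proof -
    have "norm z < 1" using that q by simp
    thus ?thesis using sq[of z] C_nz[of z] by (auto simp: power2_eq_iff)
  qed
  \<comment> \<open>A continuous function with finite range on a connected set is constant. At 0 the
    values of \<open>A\<close>, \<open>B\<close>, \<open>C\<close> are 1, 0, 1.\<close>
  have "finite ((\<lambda>z. (A z - B z) / C z) ` cball 0 (norm q))"
    by (intro finite_subset[OF image_subsetI[OF pm]]) auto
  with cont have "(\<lambda>z. (A z - B z) / C z) constant_on cball 0 (norm q)"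
    by (intro continuous_finite_range_constant convex_connected convex_cball)
  hence "(A q - B q) / C q = (A 0 - B 0) / C 0"
    unfolding constant_on_def by force
  also have "\<dots> = 1" by (simp add: A_def B_def C_def)
  finally have "A q - B q = C q" using C_nz[OF q] by (simp add: field_simps)
  thus ?thesis by (simp add: A_def B_def C_def)
qed

theorem theorem15:
  fixes q :: complex
  assumes "norm q < 1"
  shows "1 + (\<Sum>n. q ^ (Suc n)\<^sup>2 + q ^ (5 * (Suc n)\<^sup>2)) =
    qpochhammer_inf_list [q ^ 2, q ^ 8, q ^ 10] (q ^ 10)
      * qpochhammer_inf_list [q ^ 6, q ^ 14] (q ^ 20)
      / qpochhammer_inf_list [q, q ^ 4] (q ^ 5)"
proof -
  let ?A = "theta (- (q ^ 3)) (- (q ^ 2)) * theta (- (q ^ 12)) (- (q ^ 8))"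
  let ?psi = "theta (- (q ^ 3)) (- q)"
  have lt: "norm (q ^ n) < 1" if "0 < n" for n
    using that assms by (simp add: norm_power power_less_one_iff)
  have nz: "?psi \<noteq> 0" "qpochhammer_inf q (q ^ 5) \<noteq> 0" "qpochhammer_inf (q ^ 4) (q ^ 5) \<noteq> 0"
    using assms lt by (simp_all add: theta_nonzero qpochhammer_inf_nonzero)
  have "(\<lambda>n. q ^ (Suc n)\<^sup>2 + q ^ (5 * (Suc n)\<^sup>2)) sums
      ((theta q q - 1) / 2 + (theta (q ^ 5) (q ^ 5) - 1) / 2)"
    \<comment> \<open>\<open>power_mult\<close> exposes the second series as the first one at
      \<open>q ^ 5\<close>.\<close>
    unfolding power_mult by (intro sums_add sums_power_squares assms lt) simp
  hence "1 + (\<Sum>n. q ^ (Suc n)\<^sup>2 + q ^ (5 * (Suc n)\<^sup>2)) = (theta q q + theta (q ^ 5) (q ^ 5)) / 2"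
    by (simp add: sums_unique[symmetric] field_simps)
  \<comment> \<open>The formulas for \<open>A + B\<close> and \<open>A - B\<close> are added, which
    eliminates \<open>B\<close>.\<close>
  also have "2 * ?A = ?psi * (theta q q + theta (q ^ 5) (q ^ 5))"
    using theta_psi_phi_cosets[OF assms] theta_products(1)[OF assms] theta_difference[OF assms]
    by (simp add: algebra_simps)
  hence "(theta q q + theta (q ^ 5) (q ^ 5)) / 2 = ?A / ?psi"
    using nz by (simp add: field_simps)
  also have "\<dots> = qpochhammer_inf_list [q ^ 2, q ^ 8, q ^ 10] (q ^ 10)
      * qpochhammer_inf_list [q ^ 6, q ^ 14] (q ^ 20) / qpochhammer_inf_list [q, q ^ 4] (q ^ 5)"
    using theta_products(3)[OF assms] nz by (simp add: qpochhammer_inf_list_def frac_eq_eq mult_ac)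
  finally show ?thesis .
qed

end
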